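(* Let $n,k,m$ be positive integers with $n\ge k\ge 1$ and $n-m\ge 1$. Then the varied Ward-Lah numbers $V(n,k)$ satisfy $$V(n,k)=(2n)!\sum_{j=0}^{m}\frac{1}{(2(n-m))!}\binom{m}{j}\,V(n-m,k-j),$$ where terms with $j>k$ are interpreted as $0$.
   Context: Partition transformation: for integers $n,k\ge 0$ and a sequence $a_1,a_2,\dots$, $$P_n^k(a_1,a_2,\dots)=\sum_{q}(-1)^{q_0}\prod_{j=0}^{\ell(q)-1}\binom{q_j}{q_{j+1}}a_{j+1}^{q_j},$$ where the sum is over integer partitions $q=(q_0\ge q_1\ge\dots)$ of $n=q_0+q_1+\cdots$ with $q_0=k$; $\ell(q)$ is the length of $q$ (number of positive parts), so $q_{\ell(q)-1}>0$ and $q_{\ell(q)}=0$. Varied Ward-Lah numbers: for integers $n\ge k\ge 0$, $V(n,k)=(-1)^k (2n)!\,P_n^k(1,1,\dots)$ (all $a_i=1$), with $V(0,0)=1$, $V(n,0)=0$ for $n\ge 1$, $V(0,k)=0$ for $k\ge 1$, and $V(n,k)=0$ for $k>n$. *)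

theory Defs
  imports Complex_Main
begin

text \<open>
  A partition of \<open>n\<close> is a weakly decreasing sequence \<open>q 0 \<ge> q 1 \<ge> \<dots>\<close> of natural numbers
  that is eventually zero, the trailing zeros being padding.
\<close>

definition partition_length :: "(nat \<Rightarrow> nat) \<Rightarrow> nat" where
  "partition_length q = card {j. 0 < q j}"

definition partitions_of :: "nat \<Rightarrow> (nat \<Rightarrow> nat) set" where
  "partitions_of n = {q. antimono q \<and> finite {j. 0 < q j} \<and> (\<Sum>j | 0 < q j. q j) = n}"

text \<open>Only the values \<open>a 1\<close>, \<open>a 2\<close>, \<open>\<dots>\<close> of the sequence matter; \<open>a 0\<close> is never used.\<close>

definition partition_transform :: "nat \<Rightarrow> nat \<Rightarrow> (nat \<Rightarrow> 'a::comm_ring_1) \<Rightarrow> 'a" where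
  "partition_transform n k a =
    (\<Sum>q \<in> {q \<in> partitions_of n. q 0 = k}.
      (-1) ^ q 0 * (\<Prod>j<partition_length q. of_nat (q j choose q (j + 1)) * a (j + 1) ^ q j))"

text \<open>
  The boundary conventions for \<open>n = 0\<close>, \<open>k = 0\<close> and \<open>k > n\<close> need no separate clauses; see
  \<open>ward_lah_boundary\<close> below.
\<close>

definition ward_lah :: "nat \<Rightarrow> nat \<Rightarrow> int" where
  "ward_lah n k = (-1) ^ k * fact (2 * n) * partition_transform n k (\<lambda>_. 1)"

lemma partition_positive_iff:
  assumes "q \<in> partitions_of n"
  shows "0 < q j \<longleftrightarrow> j < partition_length q"
proof -
  let ?S = "{j. 0 < q j}"
  have fin: "finite ?S" and mono: "\<And>i j. i \<le> j \<Longrightarrow> q j \<le> q i"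
    using assms by (auto simp: partitions_of_def antimono_def)
  show ?thesis
  proof
    assume "0 < q j"
    then have "{..j} \<subseteq> ?S"
      using mono[of _ j] by (auto intro: less_le_trans)
    then show "j < partition_length q"
      using card_mono[OF fin, of "{..j}"] by (simp add: partition_length_def)
  next
    assume l: "j < partition_length q"
    show "0 < q j"
    proof (rule ccontr)
      assume "\<not> 0 < q j"
      then have "q i = 0" if "j \<le> i" for i
        using mono[OF that] by simp
      then have "?S \<subseteq> {..<j}"
        by (metis lessThan_iff less_irrefl linorder_not_less mem_Collect_eq subsetI)
      then show False
        using card_mono[of "{..<j}" ?S] l by (simp add: partition_length_def)
    qed
  qed
qed

lemma partition_part_le:
  assumes "q \<in> partitions_of n"
  shows "q j \<le> n"
proof (cases "0 < q j")
  case True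
  then show ?thesis
    using assms member_le_sum[of j "{j. 0 < q j}" q] by (auto simp: partitions_of_def)
qed simp

lemma partition_length_le:
  assumes "q \<in> partitions_of n"
  shows "partition_length q \<le> n"
proof -
  have "(\<Sum>j | 0 < q j. 1) \<le> (\<Sum>j | 0 < q j. q j)"
    by (rule sum_mono) auto
  then show ?thesis
    using assms by (simp add: partitions_of_def partition_length_def)
qed

lemma finite_partitions_of: "finite (partitions_of n)"
proof (rule finite_subset)
  show "partitions_of n \<subseteq> {q. \<forall>j. (j \<in> {..<n} \<longrightarrow> q j \<in> {..n}) \<and> (j \<notin> {..<n} \<longrightarrow> q j = 0)}"
  proof
    fix q assume q: "q \<in> partitions_of n"
    have "q j = 0" if "\<not> j < n" for j
      using partition_positive_iff[OF q, of j] partition_length_le[OF q] that by simp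
    then show "q \<in> {q. \<forall>j. (j \<in> {..<n} \<longrightarrow> q j \<in> {..n}) \<and> (j \<notin> {..<n} \<longrightarrow> q j = 0)}"
      using partition_part_le[OF q] by simp
  qed
  show "finite {q. \<forall>j. (j \<in> {..<n} \<longrightarrow> q j \<in> {..n}) \<and> (j \<notin> {..<n} \<longrightarrow> q j = (0::nat))}"
    by (rule finite_set_of_finite_funs) auto
qed

lemma partitions_of_0: "partitions_of 0 = {\<lambda>_. 0}"
  using partition_part_le[of _ 0] by (auto simp: partitions_of_def antimono_def)

lemma partition_first_pos:
  assumes "q \<in> partitions_of n" "0 < n"
  shows "0 < q 0"
proof (rule ccontr)
  assume "\<not> 0 < q 0"
  then have "q = (\<lambda>_. 0)"
    using assms(1) by (fastforce simp: partitions_of_def antimono_def)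
  then show False
    using assms by (simp add: partitions_of_def)
qed

lemma ward_lah_boundary:
  "ward_lah 0 0 = 1"
  "1 \<le> n \<Longrightarrow> ward_lah n 0 = 0"
  "1 \<le> k \<Longrightarrow> ward_lah 0 k = 0"
  "n < k \<Longrightarrow> ward_lah n k = 0"
proof -
  have "{q \<in> partitions_of 0. q 0 = 0} = {\<lambda>_. 0}"
    by (auto simp: partitions_of_0)
  then show "ward_lah 0 0 = 1"
    by (simp add: ward_lah_def partition_transform_def partition_length_def)
  show k: "ward_lah n k = 0" if "n < k" for n k
  proof -
    have "{q \<in> partitions_of n. q 0 = k} = {}"
      using partition_part_le[of _ n 0] that by fastforce
    then show ?thesis
      unfolding ward_lah_def partition_transform_def by (simp only: sum.empty mult_zero_right)
  qed
  show "1 \<le> k \<Longrightarrow> ward_lah 0 k = 0"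
    using k by simp
  show "ward_lah n 0 = 0" if "1 \<le> n"
  proof -
    have "{q \<in> partitions_of n. q 0 = 0} = {}"
      using partition_first_pos[of _ n] that by fastforce
    then show ?thesis
      unfolding ward_lah_def partition_transform_def by (simp only: sum.empty mult_zero_right)
  qed
qed

end

theory Submission
  imports Defs
begin

text \<open>
  Removing the first part \<open>k\<close> from a partition gives a recursion for the partition transform.
  When all \<open>a i\<close> are \<open>1\<close>, Vandermonde's convolution solves it, up to sign, by the number
  \<open>(n - 1) choose (k - 1)\<close> of compositions of \<open>n\<close> into \<open>k\<close> parts.  Hence
  \<open>V(n, k) = (2n)! ((n - 1) choose (k - 1))\<close>, and the theorem is again Vandermonde's convolution.
\<close>

lemma positive_case_nat:
  assumes "0 < k"
  shows "{j. 0 < case_nat k q j} = insert 0 (Suc ` {j. 0 < (q j :: nat)})"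
proof (rule set_eqI)
  fix j
  show "j \<in> {j. 0 < case_nat k q j} \<longleftrightarrow> j \<in> insert 0 (Suc ` {j. 0 < q j})"
    using assms by (cases j) auto
qed

lemma finite_positive_case_nat:
  assumes "0 < k"
  shows "finite {j. 0 < case_nat k q j} \<longleftrightarrow> finite {j. 0 < (q j :: nat)}"
  by (simp add: positive_case_nat[OF assms] finite_image_iff)

lemma antimono_case_nat:
  fixes q :: "nat \<Rightarrow> nat"
  shows "antimono (case_nat k q) \<longleftrightarrow> antimono q \<and> q 0 \<le> k"
  by (simp add: antimono_iff_le_Suc split: nat.splits) (metis not0_implies_Suc)

lemma partition_length_case_nat:
  assumes "0 < k" "q \<in> partitions_of n"
  shows "partition_length (case_nat k q) = Suc (partition_length q)"
  using assms by (simp add: partition_length_def positive_case_nat partitions_of_def card_image)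

text \<open>\<open>case_nat k\<close> prepends the part \<open>k\<close>: the sum grows by
  \<open>k\<close>, and \<open>q 0 \<le> k\<close> is monotonicity at the junction. With
  \<open>k \<le> n\<close> the difference \<open>n - k\<close> is not truncated.\<close>

lemma case_nat_in_partitions_of_iff:
  assumes "0 < k" "k \<le> n"
  shows "case_nat k q \<in> partitions_of n \<longleftrightarrow> q \<in> partitions_of (n - k) \<and> q 0 \<le> k"
proof -
  have "(\<Sum>j | 0 < case_nat k q j. case_nat k q j) = k + (\<Sum>j | 0 < q j. q j)"
    if "finite {j. 0 < q j}"
    using that by (simp add: positive_case_nat[OF assms(1)] sum.reindex)
  then show ?thesis
    using assms by (auto simp: partitions_of_def antimono_case_nat finite_positive_case_nat)
qed

lemma partitions_of_first_eq:
  assumes "0 < k" "k \<le> n"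
  shows "{q \<in> partitions_of n. q 0 = k} = case_nat k ` {q \<in> partitions_of (n - k). q 0 \<le> k}"
proof -
  have "q \<in> case_nat k ` {q \<in> partitions_of (n - k). q 0 \<le> k}"
    if "q \<in> partitions_of n" "q 0 = k" for q
  proof -
    have eq: "q = case_nat k (\<lambda>j. q (Suc j))"
      using that(2) by (auto simp: fun_eq_iff split: nat.splits)
    then show ?thesis
      using that(1) case_nat_in_partitions_of_iff[OF assms] by (metis (mono_tags) CollectI image_eqI)
  qed
  then show ?thesis
    using case_nat_in_partitions_of_iff[OF assms] by auto
qed

text \<open>Split each partition into its first part \<open>k\<close> and its tail. The factor at
  \<open>j = 0\<close> is \<open>k choose r\<close> times \<open>a 1 ^ k\<close>, where
  \<open>r\<close> is the first part of the tail; the other factors form the weight of the tail for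
  the shifted sequence.\<close>

lemma partition_transform_rec:
  fixes a :: "nat \<Rightarrow> 'a::comm_ring_1"
  assumes "0 < k" "k \<le> n"
  shows "partition_transform n k a =
    (- a 1) ^ k * (\<Sum>r\<le>k. (-1) ^ r * of_nat (k choose r) *
      partition_transform (n - k) r (\<lambda>i. a (Suc i)))"
proof -
  define w :: "(nat \<Rightarrow> 'a) \<Rightarrow> (nat \<Rightarrow> nat) \<Rightarrow> 'a" where
    "w = (\<lambda>a q. \<Prod>j<partition_length q. of_nat (q j choose q (j + 1)) * a (j + 1) ^ q j)"
  let ?S = "{q \<in> partitions_of (n - k). q 0 \<le> k}"
  let ?b = "\<lambda>i. a (Suc i)"
  have inj: "inj_on (case_nat k) ?S"
    by (rule inj_onI) (metis ext old.nat.simps(5))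
  have w: "w a (case_nat k q) = of_nat (k choose q 0) * a 1 ^ k * w ?b q" if "q \<in> ?S" for q
  proof -
    have "partition_length (case_nat k q) = Suc (partition_length q)"
      using that by (intro partition_length_case_nat[OF assms(1)]) auto
    then show ?thesis
      by (simp add: w_def prod.lessThan_Suc_shift del: prod.lessThan_Suc)
  qed
  have "partition_transform n k a = (\<Sum>q\<in>?S. (-1) ^ k * w a (case_nat k q))"
    unfolding partition_transform_def w_def partitions_of_first_eq[OF assms]
    by (simp add: sum.reindex[OF inj])
  also have "\<dots> = (\<Sum>q\<in>?S. (- a 1) ^ k * (of_nat (k choose q 0) * w ?b q))"
    by (intro sum.cong refl) (simp add: w power_minus[of "a 1"] power_minus[of "a (Suc 0)"] mult_ac)
  \<comment> \<open>Group the tails by their first part, so that each inner sum becomes a transform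
    of \<open>n - k\<close>.\<close>
  also have "\<dots> = (\<Sum>r\<le>k. \<Sum>q\<in>{q \<in> ?S. q 0 = r}. (- a 1) ^ k * (of_nat (k choose q 0) * w ?b q))"
    by (rule sum.group[symmetric]) (auto simp: finite_partitions_of)
  also have "\<dots> = (\<Sum>r\<le>k. (- a 1) ^ k * ((-1) ^ r * of_nat (k choose r) * partition_transform (n - k) r ?b))"
  proof (intro sum.cong refl)
    fix r assume "r \<in> {..k}"
    then have "{q \<in> ?S. q 0 = r} = {q \<in> partitions_of (n - k). q 0 = r}"
      by auto
    \<comment> \<open>The inner transform brings its own sign, which the explicit
      \<open>(-1) ^ r\<close> cancels.\<close>
    moreover have "(-1 :: 'a) ^ r * (-1) ^ r = 1"
      by (simp flip: power_add)
    ultimately show "(\<Sum>q\<in>{q \<in> ?S. q 0 = r}. (- a 1) ^ k * (of_nat (k choose q 0) * w ?b q)) =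
        (- a 1) ^ k * ((-1) ^ r * of_nat (k choose r) * partition_transform (n - k) r ?b)"
      by (simp add: partition_transform_def w_def sum_distrib_left mult.assoc mult.left_commute)
  qed
  finally show ?thesis
    by (simp add: sum_distrib_left)
qed

lemma partition_transform_zero:
  "partition_transform 0 k a = (if k = 0 then 1 else 0)"
proof -
  have "{q \<in> partitions_of 0. q 0 = k} = (if k = 0 then {\<lambda>_. 0} else {})"
    by (auto simp: partitions_of_0)
  then show ?thesis
    by (simp add: partition_transform_def partition_length_def)
qed

lemma partition_transform_first_zero:
  assumes "0 < n"
  shows "partition_transform n 0 a = 0"
proof -
  have "{q \<in> partitions_of n. q 0 = 0} = {}"
    using partition_first_pos[of _ n] assms by fastforce
  then show ?thesis
    unfolding partition_transform_def by (simp only: sum.empty)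
qed

lemma partition_transform_gt:
  assumes "n < k"
  shows "partition_transform n k a = 0"
proof -
  have "{q \<in> partitions_of n. q 0 = k} = {}"
    using partition_part_le[of _ n 0] assms by fastforce
  then show ?thesis
    unfolding partition_transform_def by (simp only: sum.empty)
qed

text \<open>Strong induction through the recursion. \<open>k\<close> is arbitrary because the
  recursion calls on every first part \<open>Suc r\<close> of the tail.\<close>

lemma partition_transform_one:
  "partition_transform (Suc n) (Suc k) (\<lambda>_. 1) =
    ((-1) ^ Suc k * of_nat (n choose k) :: 'a::comm_ring_1)"
proof (induction n arbitrary: k rule: less_induct)
  case (less n)
  let ?P = "\<lambda>n k. partition_transform n k (\<lambda>_. 1) :: 'a"
  consider "n < k" | "n = k" | p where "n = Suc (k + p)"
    by (metis less_iff_Suc_add linorder_neqE_nat)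
  then show ?case
  proof cases
    case 1
    then show ?thesis
      by (simp add: partition_transform_gt binomial_eq_0)
  next
    case 2
    \<comment> \<open>The partition is a single part, so its tail is empty and only
      \<open>r = 0\<close> survives.\<close>
    have "(\<Sum>r\<le>Suc k. (-1) ^ r * of_nat (Suc k choose r) * ?P 0 r) = 1"
      by (simp add: partition_transform_zero if_distrib[of "(*) _"] sum.delta cong: if_cong del: binomial_Suc_Suc sum.atMost_Suc)
    then show ?thesis
      using 2 by (simp add: partition_transform_rec del: binomial_Suc_Suc sum.atMost_Suc)
  next
    case 3
    have "?P (Suc n) (Suc k) =
        (-1) ^ Suc k * (\<Sum>r\<le>Suc k. (-1) ^ r * of_nat (Suc k choose r) * ?P (Suc p) r)"
      using 3 by (subst partition_transform_rec) auto
    \<comment> \<open>The tail has positive size \<open>Suc p\<close>, so the term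
      \<open>r = 0\<close> vanishes and the shifted index fits the induction hypothesis.\<close>
    also have "(\<Sum>r\<le>Suc k. (-1) ^ r * of_nat (Suc k choose r) * ?P (Suc p) r) =
        (\<Sum>r\<le>k. (-1) ^ Suc r * of_nat (Suc k choose Suc r) * ?P (Suc p) (Suc r))"
      by (subst sum.atMost_Suc_shift) (simp add: partition_transform_first_zero)
    also have "\<dots> = (\<Sum>r\<le>k. of_nat ((Suc k choose (k - r)) * (p choose r)))"
    proof (intro sum.cong refl)
      fix r assume "r \<in> {..k}"
      \<comment> \<open>After this reflection the lower indices \<open>k - r\<close> and
        \<open>r\<close> add up to \<open>k\<close>, as Vandermonde's convolution requires; the
        upper ones add up to \<open>n\<close>.\<close>
      then have "Suc k choose Suc r = Suc k choose (k - r)"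
        using binomial_symmetric[of "Suc r" "Suc k"] by simp
      moreover have "?P (Suc p) (Suc r) = (-1) ^ Suc r * of_nat (p choose r)"
        using 3 by (intro less.IH) simp
      moreover have "(-1 :: 'a) ^ Suc r * (-1) ^ Suc r = 1"
        by (simp flip: power_add)
      ultimately show "(-1) ^ Suc r * of_nat (Suc k choose Suc r) * ?P (Suc p) (Suc r) =
          of_nat ((Suc k choose (k - r)) * (p choose r))"
        by (metis (no_types, lifting) mult.assoc mult.commute mult_1 of_nat_mult)
    qed
    also have "\<dots> = of_nat (n choose k)"
      using vandermonde[of p "Suc k" k] 3
      by (simp add: mult.commute add.commute del: of_nat_mult binomial_Suc_Suc flip: of_nat_sum)
    finally show ?thesis .
  qed
qed

lemma ward_lah_eq:
  "ward_lah (Suc n) (Suc k) = fact (2 * Suc n) * int (n choose k)"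
proof -
  have "(-1 :: int) ^ Suc k * (-1) ^ Suc k = 1"
    by (simp flip: power_add)
  then show ?thesis
    unfolding ward_lah_def partition_transform_one by (metis mult.assoc mult.commute mult_1)
qed

theorem theorem4p7:
  fixes n k m :: nat
  assumes "1 \<le> k" and "k \<le> n" and "1 \<le> m" and "1 \<le> n - m"
  shows "(of_int (ward_lah n k) :: rat) =
    fact (2 * n) * (\<Sum>j=0..m. if j \<le> k
      then 1 / fact (2 * (n - m)) * of_nat (m choose j) * of_int (ward_lah (n - m) (k - j))
      else 0)"
proof -
  obtain l where k: "k = Suc l"
    using assms(1) by (cases k) auto
  obtain d where d: "n - m = Suc d"
    using assms(4) by (cases "n - m") auto
  then have n: "n = Suc (m + d)"
    by simp
  define f :: "nat \<Rightarrow> rat" where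
    "f j = (if j \<le> k
      then 1 / fact (2 * (n - m)) * of_nat (m choose j) * of_int (ward_lah (n - m) (k - j)) else 0)" for j
  have f: "f j = of_nat ((m choose j) * (d choose (l - j)))" if "j \<le> l" for j
    using that by (simp add: f_def d k Suc_diff_le ward_lah_eq del: mult_Suc_right)
  \<comment> \<open>Beyond \<open>l\<close>, the term \<open>j = k\<close> contains this zero value,
    and later terms are zero by convention.\<close>
  have "ward_lah (Suc d) 0 = 0"
    by (rule ward_lah_boundary) simp
  then have f0: "f j = 0" if "l < j" for j
    using that by (auto simp: f_def d k le_Suc_eq)
  \<comment> \<open>Pass from the range up to \<open>m\<close> to the range up to \<open>l\<close>
    through their union: terms beyond \<open>m\<close> vanish by the binomial, those beyond
    \<open>l\<close> by \<open>f0\<close>.\<close>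
  have "(\<Sum>j=0..m. f j) = (\<Sum>j\<in>{..m} \<union> {..l}. f j)"
    by (rule sum.mono_neutral_left) (auto simp: f_def binomial_eq_0)
  also have "\<dots> = (\<Sum>j\<le>l. f j)"
    by (rule sum.mono_neutral_right) (auto simp: f0)
  also have "\<dots> = of_nat ((m + d) choose l)"
    by (simp add: f vandermonde del: of_nat_mult flip: of_nat_sum)
  finally show ?thesis
    unfolding f_def[symmetric] by (simp add: n k ward_lah_eq del: mult_Suc_right)
qed

end
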